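(* For every integer $n\ge 1$, $$C_n(t,u)=A_n(t)\,N_n(t,u),$$ where $C_n(t,u)=\sum_{\pi\in\mathcal{C}_n}t^{\mathrm{des}(\pi)}u^{\mathrm{plat}(\pi)}$, $A_n(t)=\sum_{\sigma\in\mathcal{S}_n}t^{\mathrm{des}(\sigma)}$ and $N_n(t,u)=\sum_{D\in\mathcal{D}_n}t^{\mathrm{hpea}(D)}u^{\mathrm{lpea}(D)}$.
   Context: Let $[n]=\{1,\dots,n\}$ and let $[n]\sqcup[n]=\{1,1,2,2,\dots,n,n\}$ be the multiset with two copies of each element of $[n]$. A permutation $\pi=\pi_1\pi_2\dots\pi_{2n}$ of $[n]\sqcup[n]$ is nonnesting if there do not exist $i<j<\ell<m$ with $\pi_i=\pi_m$ and $\pi_j=\pi_\ell$; $\mathcal{C}_n$ denotes the set of nonnesting permutations of $[n]\sqcup[n]$. $\mathcal{S}_n$ is the set of permutations of $[n]$ in one-line notation. For a word $\pi=\pi_1\dots\pi_m$ of positive integers, $\mathrm{des}(\pi)=|\{i\in[m-1]:\pi_i>\pi_{i+1}\}|$ and $\mathrm{plat}(\pi)=|\{i\in[m-1]:\pi_i=\pi_{i+1}\}|$. $\mathcal{D}_n$ is the set of Dyck paths: lattice paths from $(0,0)$ to $(n,n)$ with steps $\mathtt{e}=(1,0)$ and $\mathtt{n}=(0,1)$ that do not go above the diagonal $y=x$. A peak of $D$ is an occurrence of two adjacent steps $\mathtt{e}\mathtt{n}$; it is a low peak if these steps touch the diagonal (i.e. the $\mathtt{e}$ step starts, equivalently the $\mathtt{n}$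 step ends, on $y=x$), and a high peak otherwise. $\mathrm{lpea}(D)$ and $\mathrm{hpea}(D)$ are the numbers of low peaks and high peaks of $D$. *)

theory Defs
  imports "HOL-Combinatorics.Multiset_Permutations"
begin

(* Words are lists, so positions are numbered from 0. *)

definition des :: "nat list \<Rightarrow> nat" where
  "des w = card {i. Suc i < length w \<and> w ! i > w ! Suc i}"

definition plat :: "nat list \<Rightarrow> nat" where
  "plat w = card {i. Suc i < length w \<and> w ! i = w ! Suc i}"

definition nonnesting :: "nat list \<Rightarrow> bool" where
  "nonnesting w \<longleftrightarrow>
     \<not> (\<exists>i j l m. i < j \<and> j < l \<and> l < m \<and> m < length w \<and> w ! i = w ! m \<and> w ! j = w ! l)"

definition nonnesting_perms :: "nat \<Rightarrow> nat list set" where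
  "nonnesting_perms n =
     {w \<in> permutations_of_multiset (mset_set {1..n} + mset_set {1..n}). nonnesting w}"

datatype step = East | North

text \<open>The lattice point reached from the origin after the first \<open>i\<close> steps of a path.\<close>

definition vertex :: "step list \<Rightarrow> nat \<Rightarrow> nat \<times> nat" where
  "vertex D i = (count_list (take i D) East, count_list (take i D) North)"

text \<open>Between consecutive vertices a path is a unit segment, so it stays weakly below the
  diagonal iff all of its vertices do.\<close>

definition dyck_paths :: "nat \<Rightarrow> step list set" where
  "dyck_paths n =
     {D. vertex D (length D) = (n, n) \<and> (\<forall>i \<le> length D. snd (vertex D i) \<le> fst (vertex D i))}"

definition peak :: "step list \<Rightarrow> nat \<Rightarrow> bool" where
  "peak D i \<longleftrightarrow> Suc i < length D \<and> D ! i = East \<and> D ! Suc i = North"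

definition on_diagonal :: "nat \<times> nat \<Rightarrow> bool" where
  "on_diagonal p \<longleftrightarrow> snd p = fst p"

definition lpea :: "step list \<Rightarrow> nat" where
  "lpea D = card {i. peak D i \<and> on_diagonal (vertex D i)}"

definition hpea :: "step list \<Rightarrow> nat" where
  "hpea D = card {i. peak D i \<and> \<not> on_diagonal (vertex D i)}"

text \<open>The generating polynomials, evaluated at elements of an arbitrary commutative ring;
  taking for \<open>'a\<close> a polynomial ring and for \<open>t\<close>, \<open>u\<close> its indeterminates gives the formal
  polynomials.\<close>

definition C_poly :: "nat \<Rightarrow> 'a::comm_ring_1 \<Rightarrow> 'a \<Rightarrow> 'a" where
  "C_poly n t u = (\<Sum>w\<in>nonnesting_perms n. t ^ des w * u ^ plat w)"

definition A_poly :: "nat \<Rightarrow> 'a::comm_ring_1 \<Rightarrow> 'a" where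
  "A_poly n t = (\<Sum>s\<in>permutations_of_set {1..n}. t ^ des s)"

definition N_poly :: "nat \<Rightarrow> 'a::comm_ring_1 \<Rightarrow> 'a \<Rightarrow> 'a" where
  "N_poly n t u = (\<Sum>D\<in>dyck_paths n. t ^ hpea D * u ^ lpea D)"

lemma finite_nonnesting_perms: "finite (nonnesting_perms n)"
  by (simp add: nonnesting_perms_def)

lemma length_eq_count_steps: "length D = count_list D East + count_list D North"
proof (induction D)
  case (Cons s D)
  then show ?case by (cases s) auto
qed simp

lemma finite_dyck_paths: "finite (dyck_paths n)"
proof (rule finite_subset)
  have "UNIV = {East, North}"
    using step.exhaust by auto
  then have "finite (UNIV :: step set)"
    by (metis finite.emptyI finite.insertI)
  then show "finite {D. set D \<subseteq> (UNIV :: step set) \<and> length D = 2 * n}"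
    by (rule finite_lists_length_eq)
  show "dyck_paths n \<subseteq> {D. set D \<subseteq> UNIV \<and> length D = 2 * n}"
    by (auto simp: dyck_paths_def vertex_def length_eq_count_steps)
qed

end

theory Submission
  imports Defs
begin

text \<open>
  A nonnesting permutation is a pair of a permutation \<open>s\<close> and a Dyck path \<open>D\<close>: reading \<open>D\<close>, the
  east steps write the letters of \<open>s\<close> in order as first copies, the north steps write them in order
  as second copies. Plateaus are exactly the low peaks of \<open>D\<close>, and for the identity the descents are
  exactly the high peaks. It therefore suffices that, over all \<open>D\<close>, the joint distribution of low
  peaks and of (descents of the word) \<open>-\<close> (descents of \<open>s\<close>) is the same for every \<open>s\<close>.

  Two moves preserve this distribution. If the values at two nonadjacent positions \<open>a < b\<close> of \<open>s\<close>
  are consecutive, they may be exchanged: the paths running along the unit cell of column \<open>b\<close> and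
  row \<open>a\<close> are paired by flipping that cell, and all other words never have these two letters next to
  each other. Hence only the descent positions of \<open>s\<close> matter. If \<open>m\<close> is one of them, the letters
  after position \<open>m\<close> may thus be assumed to be smaller than all others; making them larger than
  all others instead removes the descent \<open>m\<close> of \<open>s\<close>, and removes exactly one descent from each
  word, since every word starts with the first letter of \<open>s\<close> and ends with the last one.
\<close>

section \<open>Counting neighbouring letters in a given relation\<close>

text \<open>Generic in the relation, so that \<open>des\<close>, \<open>plat\<close> and descents
  under a value function \<open>h\<close> share the same append, map and congruence rules.\<close>

definition adj :: "('a \<Rightarrow> 'a \<Rightarrow> bool) \<Rightarrow> 'a list \<Rightarrow> nat" where
  "adj R w = card {i. Suc i < length w \<and> R (w ! i) (w ! Suc i)}"

lemma adj_Nil [simp]: "adj R [] = 0"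
  by (simp add: adj_def)

lemma adj_single [simp]: "adj R [x] = 0"
  by (simp add: adj_def)

lemma adj_Cons_Cons [simp]: "adj R (x # y # w) = of_bool (R x y) + adj R (y # w)"
proof -
  let ?S = "{i. Suc i < length (y # w) \<and> R ((y # w) ! i) ((y # w) ! Suc i)}"
  have "{i. Suc i < length (x # y # w) \<and> R ((x # y # w) ! i) ((x # y # w) ! Suc i)} =
      (if R x y then {0} else {}) \<union> Suc ` ?S" (is "?A = ?B")
  proof (rule set_eqI)
    fix i show "i \<in> ?A \<longleftrightarrow> i \<in> ?B"
      by (cases i) (auto simp: image_iff)
  qed
  moreover have "finite ?S" by (rule finite_subset[of _ "{..length (y # w)}"]) auto
  moreover have "card (Suc ` ?S) = card ?S" by (rule card_image) simp
  ultimately show ?thesis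
    unfolding adj_def by (auto simp: card_insert_if image_iff)
qed

lemma adj_append:
  assumes "u \<noteq> []" "v \<noteq> []"
  shows "adj R (u @ v) = adj R u + of_bool (R (last u) (hd v)) + adj R v"
  using assms(1)
proof (induction u rule: induct_list012)
  case (2 x)
  then show ?case using assms(2) by (cases v) auto
qed auto

lemma adj_map: "adj R (map f w) = adj (\<lambda>x y. R (f x) (f y)) w"
  unfolding adj_def by (rule arg_cong[where f = card]) auto

lemma adj_cong:
  assumes "\<And>i. Suc i < length w \<Longrightarrow> R (w ! i) (w ! Suc i) \<longleftrightarrow> S (w ! i) (w ! Suc i)"
  shows "adj R w = adj S w"
  unfolding adj_def using assms by (intro arg_cong[where f = card]) auto

lemma adj_cong_set:
  assumes "\<And>x y. x \<in> set w \<Longrightarrow> y \<in> set w \<Longrightarrow> R x y \<longleftrightarrow> S x y"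
  shows "adj R w = adj S w"
  using assms by (intro adj_cong) simp_all

lemma des_eq_adj: "des w = adj (>) w"
  by (simp add: des_def adj_def)

lemma plat_eq_adj: "plat w = adj (=) w"
  by (simp add: plat_def adj_def)

abbreviation desc :: "('a \<Rightarrow> 'b::linorder) \<Rightarrow> 'a list \<Rightarrow> nat" where
  "desc h \<equiv> adj (\<lambda>x y. h x > h y)"

section \<open>Words along Dyck paths: plateaus and descents as peaks\<close>

text \<open>The positions in \<open>s\<close> (numbered from 0) of the letters written along a path that starts at
  the point \<open>(i, j)\<close>; the word of \<open>(s, D)\<close> is \<open>map (nth s) (track D 0 0)\<close>.\<close>

fun track :: "step list \<Rightarrow> nat \<Rightarrow> nat \<Rightarrow> nat list" where
  "track [] i j = []"
| "track (East # D) i j = i # track D (Suc i) j"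
| "track (North # D) i j = j # track D i (Suc j)"

lemma track_append:
  "track (P @ Q) i j = track P i j @ track Q (i + count_list P East) (j + count_list P North)"
  by (induction P i j rule: track.induct) auto

lemma length_track [simp]: "length (track D i j) = length D"
  by (induction D i j rule: track.induct) auto

lemma mset_track:
  "mset (track D i j) =
     mset [i..<i + count_list D East] + mset [j..<j + count_list D North]"
proof (induction D i j rule: track.induct)
  case (2 D i j)
  then show ?case
    by (simp add: upt_conv_Cons del: upt_Suc)
next
  case (3 D i j)
  then show ?case
    by (simp add: upt_conv_Cons del: upt_Suc)
qed simp

lemma set_track:
  "set (track D i j) = {i..<i + count_list D East} \<union> {j..<j + count_list D North}"
  using arg_cong[OF mset_track, of set_mset D i j] by simp

lemma track_nth:
  assumes "p < length D"
  shows "track D 0 0 ! p = count_list (take p D) (D ! p)"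
proof -
  have D: "D = take p D @ D ! p # drop (Suc p) D"
    using assms by (rule id_take_nth_drop)
  have "track D 0 0 = track (take p D) 0 0 @ track (D ! p # drop (Suc p) D)
      (count_list (take p D) East) (count_list (take p D) North)"
    by (subst D, subst track_append) simp
  then show ?thesis using assms
    by (cases "D ! p") (simp_all add: nth_append)
qed

lemma dyck_paths_iff:
  "D \<in> dyck_paths n \<longleftrightarrow> count_list D East = n \<and> count_list D North = n \<and>
     (\<forall>i. count_list (take i D) North \<le> count_list (take i D) East)"
proof -
  have "(\<forall>i. count_list (take i D) North \<le> count_list (take i D) East)"
    if "\<forall>i \<le> length D. count_list (take i D) North \<le> count_list (take i D) East"
    using that by (metis linorder_le_cases order_refl take_all)
  then show ?thesis
    by (auto simp: dyck_paths_def vertex_def)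
qed

lemma dyck_length: "D \<in> dyck_paths n \<Longrightarrow> length D = 2 * n"
  by (simp add: dyck_paths_iff length_eq_count_steps)

lemma dyck_prefix_le:
  "D \<in> dyck_paths n \<Longrightarrow> count_list (take i D) North \<le> count_list (take i D) East"
  by (simp add: dyck_paths_iff)

lemma count_take_Suc:
  "i < length D \<Longrightarrow>
    count_list (take (Suc i) D) s = count_list (take i D) s + of_bool (D ! i = s)"
  by (simp add: take_Suc_conv_app_nth)

lemma set_track_dyck: "D \<in> dyck_paths n \<Longrightarrow> set (track D 0 0) = {..<n}"
  by (auto simp: set_track dyck_paths_iff)

text \<open>Equal steps write consecutive numbers. A north step followed by an east step writes the
  height \<open>j\<close> before it and then the east count \<open>i\<close>, and
  \<open>j + 1 \<le> i\<close> because the vertex between the two steps is not above the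
  diagonal.\<close>

lemma track_pair_less:
  assumes "D \<in> dyck_paths n" "Suc i < length D" "\<not> (D ! i = East \<and> D ! Suc i = North)"
  shows "track D 0 0 ! i < track D 0 0 ! Suc i"
  using assms dyck_prefix_le[OF assms(1), of i] dyck_prefix_le[OF assms(1), of "Suc i"]
  by (cases "D ! i"; cases "D ! Suc i") (auto simp: track_nth count_take_Suc)

lemma track_pair_peak:
  assumes "peak D i"
  shows "track D 0 0 ! i = count_list (take i D) East"
    and "track D 0 0 ! Suc i = count_list (take i D) North"
  using assms by (auto simp: peak_def track_nth count_take_Suc)

text \<open>Outside peaks the numbers strictly increase. A peak at the vertex \<open>(x, y)\<close>
  writes \<open>x\<close> and then \<open>y\<close>, which agree exactly on the diagonal.\<close>

lemma lpea_eq_adj: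
  assumes "D \<in> dyck_paths n"
  shows "lpea D = adj (=) (track D 0 0)"
  unfolding lpea_def adj_def
proof (intro arg_cong[where f = card] Collect_cong)
  fix i
  show "(peak D i \<and> on_diagonal (vertex D i)) =
      (Suc i < length (track D 0 0) \<and> track D 0 0 ! i = track D 0 0 ! Suc i)"
  proof (cases "peak D i")
    case True
    then show ?thesis
      using track_pair_peak[OF True] by (auto simp: on_diagonal_def vertex_def peak_def)
  next
    case False
    then show ?thesis
      using track_pair_less[OF assms, of i] by (auto simp: peak_def)
  qed
qed

text \<open>A peak at \<open>(x, y)\<close> writes \<open>x\<close> and then
  \<open>y \<le> x\<close>, a descent exactly when the vertex is off the diagonal; all other pairs
  increase.\<close>

lemma hpea_eq_adj:
  assumes "D \<in> dyck_paths n"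
  shows "hpea D = adj (>) (track D 0 0)"
  unfolding hpea_def adj_def
proof (intro arg_cong[where f = card] Collect_cong)
  fix i
  show "(peak D i \<and> \<not> on_diagonal (vertex D i)) =
      (Suc i < length (track D 0 0) \<and> track D 0 0 ! i > track D 0 0 ! Suc i)"
  proof (cases "peak D i")
    case True
    then show ?thesis
      using track_pair_peak[OF True] dyck_prefix_le[OF assms, of i]
      by (auto simp: on_diagonal_def vertex_def peak_def)
  next
    case False
    then show ?thesis
      using track_pair_less[OF assms, of i] by (auto simp: peak_def)
  qed
qed

section \<open>The joint distribution to be shown independent of the permutation\<close>

text \<open>Here \<open>h\<close> gives the value of the letter at each position, and
  \<open>desc h [0..<n]\<close> is the descent number of the permutation itself. Values are
  integers, not just \<open>1..n\<close>, so that whole blocks can be shifted; only their relative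
  order matters. The difference is taken in \<open>int\<close> because it is not yet known to be
  nonnegative.\<close>

definition excess :: "nat \<Rightarrow> (nat \<Rightarrow> int) \<Rightarrow> (int \<times> nat) multiset" where
  "excess n h = image_mset
     (\<lambda>D. (int (desc h (track D 0 0)) - int (desc h [0..<n]), lpea D)) (mset_set (dyck_paths n))"

lemma excess_eqI:
  assumes "bij_betw \<phi> (dyck_paths n) (dyck_paths n)"
    and "\<And>D. D \<in> dyck_paths n \<Longrightarrow> lpea (\<phi> D) = lpea D"
    and "\<And>D. D \<in> dyck_paths n \<Longrightarrow>
      int (desc h (track D 0 0)) - int (desc h [0..<n]) =
      int (desc h' (track (\<phi> D) 0 0)) - int (desc h' [0..<n])"
  shows "excess n h = excess n h'"
proof -
  have "mset_set (dyck_paths n) = image_mset \<phi> (mset_set (dyck_paths n))"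
    using assms(1) by (simp add: image_mset_mset_set bij_betw_def)
  then have "excess n h' = image_mset (\<lambda>D. (int (desc h' (track (\<phi> D) 0 0)) - int (desc h' [0..<n]),
      lpea (\<phi> D))) (mset_set (dyck_paths n))"
    unfolding excess_def by (metis (no_types, lifting) image_mset.compositionality comp_apply image_mset_cong)
  also have "\<dots> = excess n h"
    unfolding excess_def using assms(2,3)
    by (intro image_mset_cong) (simp add: finite_dyck_paths)
  finally show ?thesis ..
qed

section \<open>Flipping a unit cell exchanges two nonadjacent letters\<close>

text \<open>On a path through the corner \<open>(b, a)\<close>, swaps the two steps that follow it; if they differ, they
  write the letters at positions \<open>a\<close> and \<open>b\<close>.\<close>

definition flip :: "nat \<Rightarrow> nat \<Rightarrow> step list \<Rightarrow> step list" where
  "flip a b D = (if count_list (take (a + b) D) North = a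
     then take (a + b) D @ D ! Suc (a + b) # D ! (a + b) # drop (a + b + 2) D else D)"

text \<open>The vertex after \<open>a + b\<close> steps lies on the antidiagonal of
  \<open>(b, a)\<close>, so its north count alone decides whether the path passes through that
  corner.\<close>

lemma flip_cases:
  assumes "D \<in> dyck_paths n" "a < b" "b < n"
  obtains (same) "flip a b D = D" "count_list (take (a + b) D) North \<noteq> a"
  | (swap) P x y Q where "D = P @ x # y # Q" "flip a b D = P @ y # x # Q"
      "count_list P North = a" "count_list P East = b"
proof (cases "count_list (take (a + b) D) North = a")
  case False
  then show ?thesis by (auto simp: flip_def intro: same)
next
  case True
  have len: "Suc (a + b) < length D"
    using dyck_length[OF assms(1)] assms(2,3) by simp
  show ?thesis
  proof (rule swap)
    show "D = take (a + b) D @ D ! (a + b) # D ! Suc (a + b) # drop (a + b + 2) D"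
      using len by (simp add: Cons_nth_drop_Suc)
    show "flip a b D = take (a + b) D @ D ! Suc (a + b) # D ! (a + b) # drop (a + b + 2) D"
      using True by (simp add: flip_def)
    show "count_list (take (a + b) D) North = a" by (rule True)
    show "count_list (take (a + b) D) East = b"
      using length_eq_count_steps[of "take (a + b) D"] True len by simp
  qed
qed

text \<open>Only the vertex between the swapped steps moves, to \<open>(b + 1, a)\<close> or
  \<open>(b, a + 1)\<close> if at all; both are weakly below the diagonal since
  \<open>a < b\<close>.\<close>

lemma flip_dyck:
  assumes "D \<in> dyck_paths n" "a < b" "b < n"
  shows "flip a b D \<in> dyck_paths n"
  using assms
proof (cases rule: flip_cases)
  case same
  then show ?thesis using assms by simp
next
  case (swap P x y Q)
  have "count_list (take i (P @ y # x # Q)) North \<le> count_list (take i (P @ y # x # Q)) East" for i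
  proof -
    consider "i \<le> length P" | "i = Suc (length P)" | k where "i = Suc (Suc (length P)) + k"
      by (metis add_Suc le_Suc_ex not_less_eq_eq le_antisym)
    then show ?thesis
    proof cases
      case 1
      then show ?thesis using dyck_prefix_le[OF assms(1), of i] swap(1) by simp
    next
      case 2
      then show ?thesis using swap(3,4) assms(2) by simp
    next
      case 3
      then show ?thesis using dyck_prefix_le[OF assms(1), of i] swap(1) by (cases x; cases y) simp_all
    qed
  qed
  then show ?thesis
    using assms(1) unfolding dyck_paths_iff swap(2) by (auto simp: swap(1))
qed

lemma flip_flip:
  assumes "D \<in> dyck_paths n" "a < b" "b < n"
  shows "flip a b (flip a b D) = D"
  using assms
proof (cases rule: flip_cases)
  case (swap P x y Q)
  have "length P = a + b" using length_eq_count_steps[of P] swap by simp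
  then show ?thesis
    unfolding swap(2) using swap by (simp add: flip_def nth_append)
qed simp

lemma bij_flip:
  assumes "a < b" "b < n"
  shows "bij_betw (flip a b) (dyck_paths n) (dyck_paths n)"
  using assms by (intro bij_betw_byWitness[where f' = "flip a b"]) (auto simp: flip_flip flip_dyck)

text \<open>Equal steps write consecutive numbers, which \<open>a\<close> and \<open>b\<close> are
  not. Different steps write the two coordinates of the vertex before them, and below the diagonal
  the larger one is the east count.\<close>

lemma track_pair_far:
  assumes D: "D \<in> dyck_paths n" and ab: "a + 2 \<le> b" and i: "Suc i < length D"
    and pair: "{track D 0 0 ! i, track D 0 0 ! Suc i} = {a, b}"
  shows "i = a + b" "count_list (take i D) North = a" "D ! i \<noteq> D ! Suc i"
proof -
  have le: "count_list (take i D) North \<le> count_list (take i D) East"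
    by (rule dyck_prefix_le[OF D])
  have len: "i = count_list (take i D) East + count_list (take i D) North"
    using length_eq_count_steps[of "take i D"] i by simp
  have "count_list (take i D) East = b \<and> count_list (take i D) North = a \<and> D ! i \<noteq> D ! Suc i"
    using pair i ab le
    by (cases "D ! i"; cases "D ! Suc i") (auto simp: track_nth count_take_Suc doubleton_eq_iff)
  then show "i = a + b" "count_list (take i D) North = a" "D ! i \<noteq> D ! Suc i"
    using len by auto
qed

text \<open>The words are \<open>U @ [b, a] @ V\<close> and \<open>U @ [a, b] @ V\<close>. Position
  \<open>b\<close> is missing from \<open>U\<close> and \<open>a\<close> from \<open>V\<close>, so
  \<open>same\<close> settles both blocks; \<open>into\<close>, \<open>mid\<close> and
  \<open>out\<close> settle the pairs around the corner.\<close>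

lemma adj_flip_corner:
  assumes P: "count_list P East = b" "count_list P North = a"
    and Q: "count_list Q East + Suc b = n" "count_list Q North + Suc a = n"
    and ab: "a + 2 \<le> b"
    and same: "\<And>c d. c < n \<Longrightarrow> d < n \<Longrightarrow> {c, d} \<noteq> {a, b} \<Longrightarrow> R c d = S c d"
    and into: "\<And>c. c \<noteq> a \<Longrightarrow> c \<noteq> b \<Longrightarrow> R c b = S c a"
    and out: "\<And>c. c \<noteq> a \<Longrightarrow> c \<noteq> b \<Longrightarrow> R a c = S b c"
    and mid: "R b a = S a b"
  shows "adj R (track (P @ East # North # Q) 0 0) = adj S (track (P @ North # East # Q) 0 0)"
proof -
  define U where "U = track P 0 0"
  define V where "V = track Q (Suc b) (Suc a)"
  have W: "track (P @ East # North # Q) 0 0 = U @ [b, a] @ V"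
      "track (P @ North # East # Q) 0 0 = U @ [a, b] @ V"
    by (simp_all add: track_append U_def V_def P)
  have U: "set U = {0..<b} \<union> {0..<a}" by (simp add: U_def set_track P)
  have V: "set V = {Suc b..<n} \<union> {Suc a..<n}" using Q by (simp add: V_def set_track add.commute)
  have bn: "b < n" using Q by simp
  have "P \<noteq> []" using P ab by auto
  then obtain P' s where P': "P = P' @ [s]" by (metis rev_exhaust)
  have U0: "U \<noteq> []" using \<open>P \<noteq> []\<close> length_track[of P 0 0] by (auto simp: U_def simp del: length_track)
  \<comment> \<open>The neighbours of the corner are \<open>b - 1\<close> or \<open>a - 1\<close>
    before it and \<open>b + 1\<close> or \<open>a + 1\<close> after it;
    \<open>a + 2 \<le> b\<close> keeps them distinct from \<open>a\<close> and
    \<open>b\<close>.\<close>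
  have last: "last U \<noteq> a" "last U \<noteq> b"
    using P ab by (cases s; auto simp: U_def P' track_append)+
  have hd: "hd V \<noteq> a \<and> hd V \<noteq> b" if "V \<noteq> []"
  proof (cases Q)
    case Nil
    then show ?thesis using that by (simp add: V_def)
  next
    case (Cons s Q')
    then show ?thesis using ab by (cases s) (auto simp: V_def)
  qed
  have "adj R U = adj S U"
  using U bn ab by (intro adj_cong_set same) (auto simp: doubleton_eq_iff)
  moreover have "adj R V = adj S V"
  using V bn ab by (intro adj_cong_set same) (auto simp: doubleton_eq_iff)
  ultimately show ?thesis
    unfolding W using U0 last hd into out mid
    by (cases V) (simp_all add: adj_append)
qed

text \<open>The hypotheses are symmetric in \<open>R\<close> and \<open>S\<close>, so the corner
  lemma covers both orders of the two steps. Any other path is fixed by \<open>flip\<close>, and by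
  \<open>track_pair_far\<close> its word never has \<open>a\<close> next to
  \<open>b\<close>.\<close>

lemma adj_flip:
  assumes D: "D \<in> dyck_paths n" and ab: "a + 2 \<le> b" "b < n"
    and same: "\<And>c d. c < n \<Longrightarrow> d < n \<Longrightarrow> {c, d} \<noteq> {a, b} \<Longrightarrow> R c d = S c d"
    and into: "\<And>c. c \<noteq> a \<Longrightarrow> c \<noteq> b \<Longrightarrow> R c b = S c a" "\<And>c. c \<noteq> a \<Longrightarrow> c \<noteq> b \<Longrightarrow> R c a = S c b"
    and out: "\<And>c. c \<noteq> a \<Longrightarrow> c \<noteq> b \<Longrightarrow> R a c = S b c" "\<And>c. c \<noteq> a \<Longrightarrow> c \<noteq> b \<Longrightarrow> R b c = S a c"
    and mid: "R b a = S a b" "R a b = S b a"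
  shows "adj R (track D 0 0) = adj S (track (flip a b D) 0 0)"
proof -
  have ab': "a < b" using ab by simp
  have stay: "adj R (track D 0 0) = adj S (track D 0 0)"
    if "\<not> (count_list (take (a + b) D) North = a \<and> D ! (a + b) \<noteq> D ! Suc (a + b))"
  proof (rule adj_cong)
    fix i assume i: "Suc i < length (track D 0 0)"
    then have "track D 0 0 ! i \<in> set (track D 0 0)" "track D 0 0 ! Suc i \<in> set (track D 0 0)"
      using Suc_lessD nth_mem by blast+
    then show "R (track D 0 0 ! i) (track D 0 0 ! Suc i) = S (track D 0 0 ! i) (track D 0 0 ! Suc i)"
      using track_pair_far[OF D ab(1), of i] i that unfolding set_track_dyck[OF D]
      by (intro same) auto
  qed
  from D ab' ab(2) show ?thesis
  proof (cases rule: flip_cases)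
    case same
    then show ?thesis using stay by simp
  next
    case (swap P x y Q)
    show ?thesis
    proof (cases "x = y")
      case True
      have "length P = a + b" using length_eq_count_steps[of P] swap by simp
      then have "D ! (a + b) = x" "D ! Suc (a + b) = y" by (simp_all add: swap(1) nth_append)
      then show ?thesis using stay swap True by simp
    next
      case False
      have Q: "count_list Q East + Suc b = n" "count_list Q North + Suc a = n"
        using D False swap(3,4) unfolding dyck_paths_iff swap(1) by (cases x; cases y; simp)+
      show ?thesis
      proof (cases x)
        case East
        then have "y = North" using False by (cases y) auto
        then show ?thesis
          unfolding swap(2) unfolding swap(1) East
          using adj_flip_corner[OF swap(4,3) Q ab(1), of R S] same into out mid by simp
      next
        case North
        then have "y = East" using False by (cases y) auto
        then show ?thesis
          unfolding swap(2) unfolding swap(1) North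
          using adj_flip_corner[OF swap(4,3) Q ab(1), of S R] same into out mid by simp
      qed
    qed
  qed
qed

text \<open>No other value separates \<open>h a\<close> from \<open>h b\<close>, so exchanging them
  can affect only the comparison of these two with each other.\<close>

lemma less_transpose_iff:
  assumes cd: "c < n" "d < n" "{c, d} \<noteq> {a, b}"
    and between: "\<And>c. c < n \<Longrightarrow> c \<noteq> a \<Longrightarrow> c \<noteq> b \<Longrightarrow> h c < h a \<longleftrightarrow> h c < h b"
    and between': "\<And>c. c < n \<Longrightarrow> c \<noteq> a \<Longrightarrow> c \<noteq> b \<Longrightarrow> h a < h c \<longleftrightarrow> h b < h c"
  shows "(h \<circ> transpose a b) d < (h \<circ> transpose a b) c \<longleftrightarrow> h d < (h c :: 'a :: linorder)"
proof -
  consider "c = d" | "c \<noteq> a" "c \<noteq> b" "d \<noteq> a" "d \<noteq> b" | "c = a \<or> c = b" "d \<noteq> a" "d \<noteq> b"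
    | "c \<noteq> a" "c \<noteq> b" "d = a \<or> d = b"
    using cd(3) by (cases "c = a"; cases "c = b"; cases "d = a"; cases "d = b")
      (auto simp: insert_commute)
  then show ?thesis
  proof cases
    case 3
    then show ?thesis using between[OF cd(2)] by auto
  next
    case 4
    then show ?thesis using between'[OF cd(1)] by auto
  qed simp_all
qed

lemma excess_swap:
  assumes ab: "a + 2 \<le> b" "b < n"
    and between: "\<And>c. c < n \<Longrightarrow> c \<noteq> a \<Longrightarrow> c \<noteq> b \<Longrightarrow> h c < h a \<longleftrightarrow> h c < h b"
    and between': "\<And>c. c < n \<Longrightarrow> c \<noteq> a \<Longrightarrow> c \<noteq> b \<Longrightarrow> h a < h c \<longleftrightarrow> h b < h c"
  shows "excess n h = excess n (h \<circ> transpose a b)"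
proof (rule excess_eqI)
  let ?h = "h \<circ> transpose a b"
  have same: "h c > h d \<longleftrightarrow> ?h c > ?h d" if "c < n" "d < n" "{c, d} \<noteq> {a, b}" for c d
    using that between between' by (rule less_transpose_iff[symmetric])
  show "bij_betw (flip a b) (dyck_paths n) (dyck_paths n)"
    using ab by (intro bij_flip) auto
  show "lpea (flip a b D) = lpea D" if "D \<in> dyck_paths n" for D
  proof -
    have "flip a b D \<in> dyck_paths n" using that ab by (intro flip_dyck) auto
    moreover have "adj (=) (track D 0 0) = adj (=) (track (flip a b D) 0 0)"
      by (rule adj_flip[OF that ab]) auto
    ultimately show ?thesis
      using that by (simp add: lpea_eq_adj)
  qed
  show "int (desc h (track D 0 0)) - int (desc h [0..<n]) =
      int (desc ?h (track (flip a b D) 0 0)) - int (desc ?h [0..<n])" if "D \<in> dyck_paths n" for D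
  proof -
    have "desc h (track D 0 0) = desc ?h (track (flip a b D) 0 0)"
    proof (rule adj_flip[OF that ab])
      show "h d < h c \<longleftrightarrow> ?h d < ?h c" if "c < n" "d < n" "{c, d} \<noteq> {a, b}" for c d
        using that by (rule same)
    qed simp_all
    \<comment> \<open>As \<open>a\<close> and \<open>b\<close> are not neighbours in
      \<open>[0..<n]\<close>, the permutation keeps its own descents too.\<close>
    moreover have "desc h [0..<n] = desc ?h [0..<n]"
    proof (rule adj_cong)
      fix i assume "Suc i < length [0..<n]"
      then show "h ([0..<n] ! Suc i) < h ([0..<n] ! i) \<longleftrightarrow> ?h ([0..<n] ! Suc i) < ?h ([0..<n] ! i)"
        using ab by (intro same) (simp_all add: doubleton_eq_iff)
    qed
    ultimately show ?thesis by simp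
  qed
qed

section \<open>Only the descent positions matter\<close>

text \<open>The inversions of \<open>g\<close> relative to \<open>h\<close>, each pair oriented by
  increasing \<open>h\<close>; their number is the induction measure below.\<close>

definition discordant :: "nat \<Rightarrow> (nat \<Rightarrow> int) \<Rightarrow> (nat \<Rightarrow> int) \<Rightarrow> (nat \<times> nat) set" where
  "discordant n h g = {(p, q). p < n \<and> q < n \<and> h p < h q \<and> g q < g p}"

lemma finite_discordant [simp]: "finite (discordant n h g)"
  by (rule finite_subset[of _ "{..<n} \<times> {..<n}"]) (auto simp: discordant_def)

lemma excess_concordant:
  assumes "inj_on h {..<n}" "inj_on g {..<n}" "discordant n h g = {}"
  shows "excess n h = excess n g"
proof -
  have order: "h x > h y \<longleftrightarrow> g x > g y" if "x < n" "y < n" for x y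
  proof (cases "x = y")
    case False
    then have "h x \<noteq> h y" "g x \<noteq> g y"
      using assms(1,2) that by (auto dest: inj_onD)
    moreover have "(y, x) \<notin> discordant n h g" "(x, y) \<notin> discordant n h g"
      using assms(3) by simp_all
    ultimately show ?thesis
      using that by (auto simp: discordant_def)
  qed simp
  have eq: "desc h w = desc g w" if "set w \<subseteq> {..<n}" for w
    using that by (intro adj_cong_set order) auto
  show ?thesis
    by (rule excess_eqI[of id]) (auto simp: eq set_track_dyck atLeast0LessThan)
qed

text \<open>While some pair is discordant, one of minimal gap in \<open>h\<close> has consecutive
  \<open>h\<close>-values and nonadjacent positions. Exchanging its values preserves
  \<open>excess\<close> and the descent positions, and lowers the number of discordant
  pairs.\<close>

lemma excess_same_descents:
  assumes "inj_on h {..<n}" "inj_on g {..<n}"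
    and "\<And>i. Suc i < n \<Longrightarrow> h i < h (Suc i) \<longleftrightarrow> g i < g (Suc i)"
  shows "excess n h = excess n g"
  using assms(1,3)
proof (induction "card (discordant n h g)" arbitrary: h rule: less_induct)
  case less
  show ?case
  proof (cases "discordant n h g = {}")
    case True
    then show ?thesis using less.prems assms(2) by (intro excess_concordant)
  next
    case False
    let ?gap = "\<lambda>pq. nat (h (snd pq) - h (fst pq))"
    have "\<exists>z. z \<in> discordant n h g" using False by blast
    then obtain z where z: "z \<in> discordant n h g" "\<forall>z'. z' \<in> discordant n h g \<longrightarrow> ?gap z \<le> ?gap z'"
      using ex_has_least_nat[of "\<lambda>z. z \<in> discordant n h g" _ ?gap] by blast
    obtain p q where z_eq: "z = (p, q)" by (cases z)
    have pq: "(p, q) \<in> discordant n h g"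
      and min: "\<And>p' q'. (p', q') \<in> discordant n h g \<Longrightarrow> ?gap (p, q) \<le> ?gap (p', q')"
      using z by (auto simp: z_eq)
    have lt: "p < n" "q < n" "h p < h q" "g q < g p"
      using pq by (auto simp: discordant_def)
    have gap: "\<not> (h p < h c \<and> h c < h q)" if "c < n" for c
    proof
      assume c: "h p < h c \<and> h c < h q"
      \<comment> \<open>Since \<open>g q < g p\<close>, the value \<open>g c\<close> is below
        \<open>g p\<close> or above \<open>g q\<close>; either way \<open>c\<close> forms a
        discordant pair of smaller gap.\<close>
      have "g c < g p \<or> g q < g c" using lt(4) by auto
      then have "(p, c) \<in> discordant n h g \<or> (c, q) \<in> discordant n h g"
        using c lt that by (auto simp: discordant_def)
      then show False using min[of p c] min[of c q] c by auto
    qed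
    have ne: "h c \<noteq> h d" if "c < n" "d < n" "c \<noteq> d" for c d
      using that less.prems(1) by (auto dest: inj_onD)
    \<comment> \<open>Neighbouring positions compare alike under \<open>h\<close> and
      \<open>g\<close>, hence are never discordant.\<close>
    have consec: "q \<noteq> Suc p" "p \<noteq> Suc q"
      using lt less.prems(2)[of p] less.prems(2)[of q] by auto
    define h' where "h' = h \<circ> transpose p q"
    have between: "h c < h p \<longleftrightarrow> h c < h q" "h p < h c \<longleftrightarrow> h q < h c"
      if "c < n" "c \<noteq> p" "c \<noteq> q" for c
      using gap[OF that(1)] ne[OF that(1) lt(1)] ne[OF that(1) lt(2)] that lt(3) by auto
    have order: "h' c < h' d \<longleftrightarrow> h c < h d" if "c < n" "d < n" "{c, d} \<noteq> {p, q}" for c d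
      unfolding h'_def by (rule less_transpose_iff[where n = n]) (use that between in auto)
    have "excess n h = excess n h'"
    proof (cases "p < q")
      case True
      then show ?thesis unfolding h'_def
        using lt consec between by (intro excess_swap) auto
    next
      case False
      have "p \<noteq> q" using lt by auto
      then have "excess n h = excess n (h \<circ> transpose q p)"
        using False lt consec between by (intro excess_swap) auto
      then show ?thesis by (simp add: h'_def transpose_commute)
    qed
    also have "excess n h' = excess n g"
    proof (rule less.hyps)
      \<comment> \<open>The exchange makes \<open>p\<close> and \<open>q\<close> concordant and
        leaves all other comparisons as they were.\<close>
      have "discordant n h' g \<subseteq> discordant n h g - {(p, q)}"
      proof
        fix z assume z: "z \<in> discordant n h' g"
        obtain c d where cd: "z = (c, d)" by (cases z)
        have *: "c < n" "d < n" "h' c < h' d" "g d < g c"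
          using z by (auto simp: cd discordant_def)
        have "{c, d} \<noteq> {p, q}"
          using * lt by (auto simp: doubleton_eq_iff h'_def)
        then show "z \<in> discordant n h g - {(p, q)}"
          using * order[of c d] by (auto simp: cd discordant_def)
      qed
      then show "card (discordant n h' g) < card (discordant n h g)"
        using pq by (intro psubset_card_mono) auto
      have "inj_on h (transpose p q ` {..<n})"
        using lt less.prems(1) by simp
      then show "inj_on h' {..<n}"
        unfolding h'_def by (intro comp_inj_on) simp_all
      show "h' i < h' (Suc i) \<longleftrightarrow> g i < g (Suc i)" if "Suc i < n" for i
      proof -
        have "{i, Suc i} \<noteq> {p, q}" using consec by (auto simp: doubleton_eq_iff)
        then show ?thesis
          using order[of i "Suc i"] less.prems(2)[OF that] that by simp
      qed
    qed
    finally show ?thesis .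
  qed
qed

section \<open>Removing one descent of the permutation\<close>

text \<open>Raising \<open>U\<close> from below to above all other letters turns the descents entering \<open>U\<close> into
  ascents and the ascents leaving \<open>U\<close> into descents; entries and exits alternate along the word.\<close>

lemma desc_raise:
  assumes "\<And>c d. c \<in> set w \<Longrightarrow> d \<in> set w \<Longrightarrow> c \<in> U \<longleftrightarrow> d \<in> U \<Longrightarrow> h d < h c \<longleftrightarrow> g d < g c"
    and "\<And>c d. c \<in> set w \<Longrightarrow> d \<in> set w \<Longrightarrow> c \<notin> U \<Longrightarrow> d \<in> U \<Longrightarrow> h d < h c \<and> g c < g d"
    and "w \<noteq> []"
  shows "desc h w + of_bool (hd w \<in> U) = desc g w + of_bool (last w \<in> U)"
  using assms
proof (induction w rule: induct_list012)
  case (3 x y w)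
  have "desc h (y # w) + of_bool (hd (y # w) \<in> U) = desc g (y # w) + of_bool (last (y # w) \<in> U)"
  proof (rule 3(2))
    fix c d assume "c \<in> set (y # w)" "d \<in> set (y # w)"
    then have cd: "c \<in> set (x # y # w)" "d \<in> set (x # y # w)" by simp_all
    show "h d < h c \<longleftrightarrow> g d < g c" if "c \<in> U \<longleftrightarrow> d \<in> U" using cd that by (rule 3(3))
    show "h d < h c \<and> g c < g d" if "c \<notin> U" "d \<in> U" using cd that by (rule 3(4))
  qed simp
  then have IH: "desc h (y # w) + of_bool (y \<in> U) = desc g (y # w) + of_bool (last (y # w) \<in> U)"
    by simp
  show ?case
  proof (cases "x \<in> U \<longleftrightarrow> y \<in> U")
    case True
    then have "h y < h x \<longleftrightarrow> g y < g x" by (intro 3(3)) simp_all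
    then show ?thesis using IH True by simp
  next
    case False
    show ?thesis
    proof (cases "x \<in> U")
      case True
      then have "h x < h y \<and> g y < g x" using False by (intro 3(4)) simp_all
      then show ?thesis using IH True False by auto
    next
      case x: False
      then have "h y < h x \<and> g x < g y" using False by (intro 3(4)) simp_all
      then show ?thesis using IH x False by auto
    qed
  qed
qed auto

text \<open>The first step has none before it. The last step, in either direction, is preceded by
  \<open>n - 1\<close> steps of its own direction.\<close>

lemma hd_last_track_dyck:
  assumes D: "D \<in> dyck_paths n" and n: "n > 0"
  shows "track D 0 0 \<noteq> []" "hd (track D 0 0) = 0" "last (track D 0 0) = n - 1"
proof -
  have len: "length D = 2 * n" using dyck_length[OF D] .
  show ne: "track D 0 0 \<noteq> []" using len n length_track[of D 0 0] by (auto simp del: length_track)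
  show "hd (track D 0 0) = 0"
    using len n by (simp add: hd_conv_nth[OF ne] track_nth)
  let ?k = "length D - 1"
  have "count_list D (D ! ?k) = n"
    using D by (cases "D ! ?k") (simp_all add: dyck_paths_iff)
  then have "count_list (take ?k D) (D ! ?k) = n - 1"
    using count_take_Suc[of ?k D "D ! ?k"] len n by simp
  then show "last (track D 0 0) = n - 1"
    using len n by (simp add: last_conv_nth[OF ne] track_nth)
qed

text \<open>The values after position \<open>m\<close> are moved below all others in
  \<open>low\<close> and above all others in \<open>high\<close>. The descent pattern of
  \<open>low\<close> is that of \<open>h\<close>; passing to \<open>high\<close> costs every word
  and the permutation itself one descent, which cancels in \<open>excess\<close>.\<close>

lemma excess_descent_removal:
  assumes inj: "inj_on h {..<n}" and m: "Suc m < n" "h (Suc m) < h m"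
  obtains g where "inj_on g {..<n}" "excess n h = excess n g"
    "desc h [0..<n] = Suc (desc g [0..<n])"
proof -
  define B where "B = (\<Sum>c<n. \<bar>h c\<bar>)"
  have B: "\<bar>h c\<bar> \<le> B" if "c < n" for c
    unfolding B_def using that by (intro member_le_sum) auto
  \<comment> \<open>Two values of \<open>h\<close> differ by at most \<open>2 * B\<close>, so a
    shift by \<open>K\<close> separates the two blocks.\<close>
  define K where "K = 2 * B + 1"
  define low where "low = (\<lambda>c. if c \<le> m then h c else h c - K)"
  define high where "high = (\<lambda>c. if c \<le> m then h c else h c + K)"
  have sep: "h d - K < h c" "h c < h d + K" if "c < n" "d < n" for c d
    using B[OF that(1)] B[OF that(2)] by (auto simp: K_def abs_if split: if_splits)
  have ne: "h c \<noteq> h d" if "c < n" "d < n" "c \<noteq> d" for c d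
    using that inj by (auto dest: inj_onD)
  have inj_low: "inj_on low {..<n}"
  proof (rule inj_onI, rule ccontr)
    fix c d assume "c \<in> {..<n}" "d \<in> {..<n}" "low c = low d" "c \<noteq> d"
    then show False using sep[of c d] sep[of d c] ne[of c d] by (auto simp: low_def split: if_splits)
  qed
  have inj_high: "inj_on high {..<n}"
  proof (rule inj_onI, rule ccontr)
    fix c d assume "c \<in> {..<n}" "d \<in> {..<n}" "high c = high d" "c \<noteq> d"
    then show False using sep[of c d] sep[of d c] ne[of c d] by (auto simp: high_def split: if_splits)
  qed
  \<comment> \<open>Only the comparison across \<open>m\<close> is affected by the shift, and there
    both \<open>h\<close> and \<open>low\<close> descend.\<close>
  have low_pattern: "h i < h (Suc i) \<longleftrightarrow> low i < low (Suc i)" if "Suc i < n" for i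
    using sep(1)[of i "Suc i"] that m by (cases "i = m") (auto simp: low_def)
  have low: "excess n h = excess n low"
    using inj inj_low low_pattern by (rule excess_same_descents)
  \<comment> \<open>Starting at \<open>0 \<le> m\<close> and ending at \<open>n - 1 > m\<close>,
    such a word enters the shifted block once more than it leaves it. The claim covers both the
    tracks and \<open>[0..<n]\<close>.\<close>
  have shift: "desc low w = Suc (desc high w)"
    if w: "w \<noteq> []" "hd w = 0" "last w = n - 1" "set w \<subseteq> {..<n}" for w
  proof -
    have "desc low w + of_bool (hd w \<in> {m<..}) = desc high w + of_bool (last w \<in> {m<..})"
    proof (rule desc_raise[OF _ _ w(1)])
      fix c d assume cd: "c \<in> set w" "d \<in> set w"
      show "low d < low c \<longleftrightarrow> high d < high c" if "c \<in> {m<..} \<longleftrightarrow> d \<in> {m<..}"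
        using that by (auto simp: low_def high_def)
      show "low d < low c \<and> high c < high d" if "c \<notin> {m<..}" "d \<in> {m<..}"
        using that sep[of c d] cd w(4) by (auto simp: low_def high_def)
    qed
    then show ?thesis using w m by simp
  qed
  have low_id: "desc low [0..<n] = Suc (desc high [0..<n])"
    using m by (intro shift) auto
  have "excess n low = excess n high"
  proof (rule excess_eqI[of id])
    fix D assume D: "D \<in> dyck_paths n"
    have "desc low (track D 0 0) = Suc (desc high (track D 0 0))"
      using hd_last_track_dyck[OF D] m set_track_dyck[OF D] by (intro shift) auto
    then show "int (desc low (track D 0 0)) - int (desc low [0..<n]) =
        int (desc high (track (id D) 0 0)) - int (desc high [0..<n])"
      using low_id by simp
  qed simp_all
  moreover have "desc h [0..<n] = desc low [0..<n]"
  proof (rule adj_cong)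
    fix i assume "Suc i < length [0..<n]"
    then have i: "Suc i < n" by simp
    then have "h i \<noteq> h (Suc i)" "low i \<noteq> low (Suc i)"
      using ne[of i "Suc i"] inj_onD[OF inj_low, of i "Suc i"] by auto
    then show "h ([0..<n] ! Suc i) < h ([0..<n] ! i) \<longleftrightarrow> low ([0..<n] ! Suc i) < low ([0..<n] ! i)"
      using low_pattern[OF i] i by auto
  qed
  ultimately show ?thesis
    using that[OF inj_high] low low_id by simp
qed

text \<open>Descents are removed one at a time; once none is left, the descent pattern is that of
  the identity permutation, represented by \<open>int\<close>.\<close>

lemma excess_eq_int:
  assumes "inj_on h {..<n}"
  shows "excess n h = excess n int"
  using assms
proof (induction "desc h [0..<n]" arbitrary: h rule: less_induct)
  case less
  show ?case
  proof (cases "\<exists>m. Suc m < n \<and> h (Suc m) < h m")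
    case True
    then obtain m where "Suc m < n" "h (Suc m) < h m" by blast
    with less.prems obtain g where g: "inj_on g {..<n}" "excess n h = excess n g"
        "desc h [0..<n] = Suc (desc g [0..<n])"
      by (rule excess_descent_removal)
    then show ?thesis using less.hyps[of g] by simp
  next
    case False
    show ?thesis
    proof (rule excess_same_descents)
      fix i assume "Suc i < n"
      moreover from this have "h i \<noteq> h (Suc i)"
        using inj_onD[OF less.prems, of i "Suc i"] by auto
      ultimately show "h i < h (Suc i) \<longleftrightarrow> int i < int (Suc i)"
        using False by force
    qed (use less.prems in auto)
  qed
qed

section \<open>The contribution of a fixed permutation\<close>

lemma sum_fixed_order:
  fixes t u :: "'a::comm_ring_1"
  assumes s: "distinct s" "length s = n"
  shows "(\<Sum>D\<in>dyck_paths n. t ^ des (map (nth s) (track D 0 0)) * u ^ plat (map (nth s) (track D 0 0)))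
    = t ^ des s * N_poly n t u"
proof -
  define h where "h = (\<lambda>i. int (s ! i))"
  \<comment> \<open>Turns an entry of \<open>excess\<close> back into a monomial: adding
    \<open>des s\<close> restores the descent number of the word. The sum is nonnegative for both
    \<open>h\<close> and \<open>int\<close>, so \<open>nat\<close> loses nothing.\<close>
  define f where "f = (\<lambda>(z, l). t ^ nat (int (des s) + z) * u ^ l)"
  have inj: "inj_on (nth s) {..<n}" using s by (simp add: inj_on_nth)
  then have inj_h: "inj_on h {..<n}" by (auto simp: h_def inj_on_def)
  have desc_h: "desc h w = des (map (nth s) w)" for w
    by (simp add: des_eq_adj adj_map h_def)
  have des_s: "desc h [0..<n] = des s"
    using s(2) by (auto simp: desc_h map_nth)
  have "adj (\<lambda>x y. y < x) [0..<n] = adj (\<lambda>x y. False) [0..<n]"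
    by (rule adj_cong) auto
  then have id: "adj (\<lambda>x y. y < x) [0..<n] = 0" by (simp add: adj_def)
  have plat: "plat (map (nth s) (track D 0 0)) = lpea D" if D: "D \<in> dyck_paths n" for D
  proof -
    have "adj (\<lambda>x y. s ! x = s ! y) (track D 0 0) = adj (=) (track D 0 0)"
      using inj by (intro adj_cong_set) (simp add: set_track_dyck[OF D] inj_on_eq_iff)
    then show ?thesis by (simp add: plat_eq_adj adj_map lpea_eq_adj[OF D])
  qed
  have "(\<Sum>D\<in>dyck_paths n. t ^ des (map (nth s) (track D 0 0)) * u ^ plat (map (nth s) (track D 0 0)))
      = (\<Sum>D\<in>dyck_paths n. f (int (desc h (track D 0 0)) - int (desc h [0..<n]), lpea D))"
    by (intro sum.cong refl) (simp add: f_def plat desc_h des_s[unfolded desc_h])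
  also have "\<dots> = sum_mset (image_mset f (excess n h))"
    unfolding excess_def sum_unfold_sum_mset by (simp only: multiset.map_comp comp_def)
  also have "excess n h = excess n int"
    by (rule excess_eq_int[OF inj_h])
  also have "sum_mset (image_mset f (excess n int)) =
      (\<Sum>D\<in>dyck_paths n. f (int (desc int (track D 0 0)) - int (desc int [0..<n]), lpea D))"
    unfolding excess_def sum_unfold_sum_mset by (simp only: multiset.map_comp comp_def)
  also have "\<dots> = (\<Sum>D\<in>dyck_paths n. t ^ des s * (t ^ hpea D * u ^ lpea D))"
    by (intro sum.cong refl)
      (simp add: f_def id hpea_eq_adj nat_add_distrib power_add mult.assoc)
  finally show ?thesis
    by (simp add: N_poly_def sum_distrib_left)
qed

section \<open>The bijection between pairs and nonnesting permutations\<close>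

text \<open>\<open>remdups\<close> keeps the last copy of each letter, so the two reversals keep the
  first. On the word of \<open>(s, D)\<close> this recovers \<open>s\<close>, and
  \<open>steps_of\<close> recovers \<open>D\<close>.\<close>

definition firsts :: "'a list \<Rightarrow> 'a list" where
  "firsts w = rev (remdups (rev w))"

definition steps_of :: "'a list \<Rightarrow> step list" where
  "steps_of w = map (\<lambda>p. if w ! p \<in> set (take p w) then North else East) [0..<length w]"

lemma firsts_Nil [simp]: "firsts [] = []"
  and firsts_snoc: "firsts (w @ [x]) = firsts w @ (if x \<in> set w then [] else [x])"
  and set_firsts [simp]: "set (firsts w) = set w"
  and distinct_firsts [simp]: "distinct (firsts w)"
  by (simp_all add: firsts_def)

lemma steps_of_Nil [simp]: "steps_of [] = []"
  by (simp add: steps_of_def)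

lemma steps_of_snoc:
  "steps_of (w @ [x]) = steps_of w @ [if x \<in> set w then North else East]"
  by (auto simp: steps_of_def nth_append)

lemma length_steps_of [simp]: "length (steps_of w) = length w"
  by (simp add: steps_of_def)

lemma take_steps_of: "take i (steps_of w) = steps_of (take i w)"
  by (auto simp: steps_of_def take_map min_def intro!: nth_equalityI)

lemma count_steps_of_East: "count_list (steps_of w) East = length (firsts w)"
  by (induction w rule: rev_induct) (simp_all add: steps_of_snoc firsts_snoc)

lemma firsts_append_prefix: "\<exists>z. firsts (u @ v) = firsts u @ z"
proof (induction v rule: rev_induct)
  case (snoc x v)
  then show ?case using firsts_snoc[of "u @ v" x] by auto
qed simp

text \<open>Supplies the two left positions of a nesting in \<open>track_steps_of\<close>.\<close>

lemma firsts_order: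
  assumes "m < k" "k < length (firsts w)"
  shows "\<exists>p q. p < q \<and> q < length w \<and> w ! p = firsts w ! m \<and> w ! q = firsts w ! k"
  using assms
proof (induction w rule: rev_induct)
  case (snoc x w)
  show ?case
  proof (cases "k < length (firsts w)")
    case True
    then obtain p q where "p < q" "q < length w" "w ! p = firsts w ! m" "w ! q = firsts w ! k"
      using snoc by blast
    then show ?thesis
      using True snoc.prems(1)
      by (intro exI[of _ p] exI[of _ q]) (auto simp: firsts_snoc nth_append)
  next
    case False
    then have x: "x \<notin> set w" "k = length (firsts w)"
      using snoc.prems(2) by (auto simp: firsts_snoc split: if_splits)
    then have "firsts w ! m \<in> set w"
      using snoc.prems(1) nth_mem[of m "firsts w"] by simp
    then obtain p where "p < length w" "w ! p = firsts w ! m"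
      by (auto simp: in_set_conv_nth)
    then show ?thesis
      using x snoc.prems(1)
      by (intro exI[of _ p] exI[of _ "length w"]) (auto simp: firsts_snoc nth_append)
  qed
qed simp

lemma track_snoc: "track (D @ [x]) 0 0 = track D 0 0 @ [count_list D x]"
  by (cases x) (simp_all add: track_append)

text \<open>After a prefix with \<open>e\<close> east steps exactly the first \<open>e\<close>
  letters of \<open>s\<close> have appeared: the next east step writes a new letter, and a north
  step one of these again. Truncating \<open>s\<close> makes the claim inductive in
  \<open>D\<close>.\<close>

lemma decode_track:
  assumes "\<And>i. count_list (take i D) North \<le> count_list (take i D) East"
    and "distinct s" "count_list D East \<le> length s"
  shows "steps_of (map (nth s) (track D 0 0)) = D"
    and "firsts (map (nth s) (track D 0 0)) = take (count_list D East) s"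
proof -
  have "steps_of (map (nth s) (track D 0 0)) = D \<and>
      firsts (map (nth s) (track D 0 0)) = take (count_list D East) s"
    using assms(1,3)
  proof (induction D rule: rev_induct)
    case (snoc x D)
    have pre: "count_list (take i D) North \<le> count_list (take i D) East" for i
      using snoc.prems(1)[of "min i (length D)"] by (simp add: min_def split: if_splits)
    have E: "count_list D East \<le> length s" using snoc.prems(2) by simp
    have IH: "steps_of (map (nth s) (track D 0 0)) = D"
        "firsts (map (nth s) (track D 0 0)) = take (count_list D East) s"
      using snoc.IH[OF pre E] by auto
    have set: "set (map (nth s) (track D 0 0)) = nth s ` {..<count_list D East}"
      using pre[of "length D"] by (auto simp: set_track)
    show ?case
    proof (cases x)
      case East
      then have "s ! count_list D East \<notin> set (map (nth s) (track D 0 0))"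
        unfolding set using assms(2) snoc.prems(2) by (auto simp: nth_eq_iff_index_eq)
      then show ?thesis
        using IH snoc.prems(2) by (simp add: East track_snoc steps_of_snoc firsts_snoc take_Suc_conv_app_nth del: set_map)
    next
      case North
      then have "s ! count_list D North \<in> set (map (nth s) (track D 0 0))"
        unfolding set using snoc.prems(1)[of "Suc (length D)"] by auto
      then show ?thesis
        using IH by (simp add: North track_snoc steps_of_snoc firsts_snoc del: set_map)
    qed
  qed simp
  then show "steps_of (map (nth s) (track D 0 0)) = D"
    and "firsts (map (nth s) (track D 0 0)) = take (count_list D East) s" by auto
qed

text \<open>Stated for prefixes \<open>P\<close> of the word, with letters taken from the whole
  word, so that \<open>P\<close> can grow by one letter. A new letter is the next one of
  \<open>firsts\<close>; a repeated one must be the earliest letter still awaiting its second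
  copy.\<close>

lemma track_steps_of:
  assumes "nonnesting (P @ Q)" and two: "\<And>x. x \<in> set (P @ Q) \<Longrightarrow> count (mset (P @ Q)) x = 2"
  shows "map (nth (firsts (P @ Q))) (track (steps_of P) 0 0) = P"
    and "count_list (steps_of P) North \<le> count_list (steps_of P) East"
proof -
  have "map (nth (firsts (P @ Q))) (track (steps_of P) 0 0) = P \<and>
      count_list (steps_of P) North \<le> count_list (steps_of P) East"
    using assms
  proof (induction P arbitrary: Q rule: rev_induct)
    case (snoc x P)
    define s where "s = firsts (P @ x # Q)"
    define e where "e = count_list (steps_of P) East"
    define m where "m = count_list (steps_of P) North"
    have W: "(P @ [x]) @ Q = P @ x # Q" by simp
    have nonnest: "nonnesting (P @ x # Q)" and two: "y \<in> set (P @ x # Q) \<Longrightarrow> count (mset (P @ x # Q)) y = 2" for y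
      using snoc.prems unfolding W by auto
    have IH: "map (nth s) (track (steps_of P) 0 0) = P" "m \<le> e"
      using snoc.IH[OF nonnest two] by (auto simp: s_def m_def e_def)
    have e: "e = length (firsts P)" by (simp add: e_def count_steps_of_East)
    obtain z where z: "s = firsts P @ z"
      using firsts_append_prefix[of P "x # Q"] by (auto simp: s_def)
    have dist: "distinct s" by (simp add: s_def)
    show ?case
    proof (cases "x \<in> set P")
      case False
      obtain z' where "s = firsts (P @ [x]) @ z'"
        using firsts_append_prefix[of "P @ [x]" Q] by (auto simp: s_def)
      then have "s ! e = x" using False by (simp add: firsts_snoc e)
      then show ?thesis
        using False IH by (simp add: steps_of_snoc track_snoc s_def[symmetric] e_def[symmetric] m_def[symmetric])
    next
      case True
      have take_e: "take e s = firsts P" by (simp add: z e)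
      have el: "e \<le> length s" by (simp add: z e)
      have upt: "map (nth s) [0..<k] = take k s" if "k \<le> length s" for k
        using that by (intro nth_equalityI) simp_all
      \<comment> \<open>By induction \<open>P\<close> consists of the first \<open>e\<close> letters
        of \<open>s\<close> and the first \<open>m\<close> of them again, so exactly those
        \<open>m\<close> have both copies in \<open>P\<close>.\<close>
      have "mset P = mset (map (nth s) (track (steps_of P) 0 0))"
        by (simp only: IH)
      also have "\<dots> = mset (map (nth s) [0..<e]) + mset (map (nth s) [0..<m])"
        by (simp add: mset_track e_def m_def)
      also have "\<dots> = mset (firsts P) + mset (take m s)"
        using IH(2) el by (simp only: upt take_e le_trans)
      finally have cnt: "count (mset P) y = count (mset (firsts P)) y + count (mset (take m s)) y" for y
        by simp
      have once: "count (mset v) y = of_bool (y \<in> set v)" if "distinct v" for v and y :: 'a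
        using that by (simp add: distinct_count_atmost_1)
      have cnt: "count (mset P) y = of_bool (y \<in> set P) + of_bool (y \<in> set (take m s))" for y
        using cnt dist by (simp add: once)
      have "x \<notin> set (take m s)"
        using cnt[of x] two[of x] True by auto
      moreover have "x \<in> set (take e s)" using True by (simp add: take_e)
      then obtain k where k: "k < e" "s ! k = x"
        using el by (auto simp: in_set_conv_nth)
      ultimately have "m \<le> k"
        using el by (auto simp: in_set_conv_nth not_less[symmetric])
      \<comment> \<open>Otherwise \<open>s ! m\<close> precedes \<open>x\<close> in \<open>P\<close>
        and has its second copy in \<open>Q\<close>, so its two copies enclose both copies of
        \<open>x\<close>, a nesting.\<close>
      have "s ! m = x"
      proof (rule ccontr)
        assume y: "s ! m \<noteq> x"
        then have mk: "m < k" using k \<open>m \<le> k\<close> by (cases "m = k") auto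
        then have mP: "s ! m = firsts P ! m" "s ! k = firsts P ! k" using k by (simp_all add: z e nth_append)
        have "s ! m \<in> set P"
          using mP mk k nth_mem[of m "firsts P"] by (simp add: e)
        moreover have "s ! m \<notin> set (take m s)"
          using dist el mk k by (auto simp: in_set_conv_nth nth_eq_iff_index_eq)
        ultimately have "count (mset Q) (s ! m) = 1"
          using two[of "s ! m"] cnt[of "s ! m"] y by auto
        then have "s ! m \<in> set Q" by (metis count_mset_0_iff zero_neq_one)
        then obtain r where r: "r < length Q" "Q ! r = s ! m" by (auto simp: in_set_conv_nth)
        obtain p q where pq: "p < q" "q < length P" "P ! p = s ! m" "P ! q = s ! k"
          using firsts_order[OF mk, of P] k(1) unfolding mP e by blast
        have "p < q \<and> q < length P \<and> length P < Suc (length P) + r \<and>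
            Suc (length P) + r < length (P @ x # Q) \<and>
            (P @ x # Q) ! p = (P @ x # Q) ! (Suc (length P) + r) \<and>
            (P @ x # Q) ! q = (P @ x # Q) ! length P"
          using pq r k by (simp add: nth_append)
        then show False using nonnest unfolding nonnesting_def by blast
      qed
      then show ?thesis
        using True IH \<open>m \<le> k\<close> k by (simp add: steps_of_snoc track_snoc s_def[symmetric] e_def[symmetric] m_def[symmetric])
    qed
  qed simp
  then show "map (nth (firsts (P @ Q))) (track (steps_of P) 0 0) = P"
    and "count_list (steps_of P) North \<le> count_list (steps_of P) East" by auto
qed

lemma count_take_less:
  assumes "p < q" "q \<le> length D"
  shows "count_list (take p D) (D ! p) < count_list (take q D) (D ! p)"
proof -
  have "take q D = take (Suc p) D @ drop (Suc p) (take q D)"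
    using assms by (metis append_take_drop_id min.absorb1 Suc_leI take_take)
  then have "count_list (take q D) (D ! p) \<ge> count_list (take (Suc p) D) (D ! p)"
    by (metis count_list_append le_add1)
  then show ?thesis
    using assms count_take_Suc[of p D "D ! p"] by simp
qed

text \<open>Steps in one direction write increasing numbers. A north step at \<open>p\<close> writes
  less than the north count before \<open>q\<close>, which is at most the number that an east step
  at \<open>q\<close> would write.\<close>

lemma track_eq_imp:
  assumes D: "D \<in> dyck_paths n" and pq: "p < q" "q < length D"
    and eq: "track D 0 0 ! p = track D 0 0 ! q"
  shows "D ! p = East" "D ! q = North"
proof -
  have "count_list (take p D) (D ! p) = count_list (take q D) (D ! q)"
    using eq pq by (simp add: track_nth)
  moreover have "count_list (take p D) (D ! p) < count_list (take q D) (D ! p)"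
    using pq by (intro count_take_less) auto
  ultimately have "D ! p = East \<and> D ! q = North"
    using dyck_prefix_le[OF D, of q] by (cases "D ! p"; cases "D ! q") auto
  then show "D ! p = East" "D ! q = North" by auto
qed

text \<open>First copies come from east steps and second copies from north steps, each in increasing
  order of position in \<open>s\<close>; a nesting would put its two letters in opposite
  orders.\<close>

lemma nonnesting_track:
  assumes D: "D \<in> dyck_paths n" and s: "distinct s" "length s = n"
  shows "nonnesting (map (nth s) (track D 0 0))"
  unfolding nonnesting_def
proof (intro notI, elim exE conjE)
  let ?w = "map (nth s) (track D 0 0)"
  fix i j l m
  assume ord: "i < j" "j < l" "l < m" "m < length ?w" and eq: "?w ! i = ?w ! m" "?w ! j = ?w ! l"
  have inj: "track D 0 0 ! p = track D 0 0 ! q" if "?w ! p = ?w ! q" "p < length D" "q < length D" for p q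
  proof -
    have "track D 0 0 ! p \<in> set (track D 0 0)" "track D 0 0 ! q \<in> set (track D 0 0)"
      using that by (simp_all del: set_track)
    then have "track D 0 0 ! p < n" "track D 0 0 ! q < n"
      by (auto simp: set_track_dyck[OF D])
    then show ?thesis using that s by (simp add: nth_eq_iff_index_eq)
  qed
  have im: "track D 0 0 ! i = track D 0 0 ! m" and jl: "track D 0 0 ! j = track D 0 0 ! l"
    using inj[OF eq(1)] inj[OF eq(2)] ord by auto
  have "D ! i = East" "D ! m = North" "D ! j = East" "D ! l = North"
    using track_eq_imp[OF D _ _ im] track_eq_imp[OF D _ _ jl] ord by auto
  then have "track D 0 0 ! i < track D 0 0 ! j" "track D 0 0 ! l < track D 0 0 ! m"
    using count_take_less[of i j D] count_take_less[of l m D] ord by (auto simp: track_nth)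
  then show False using im jl by simp
qed

lemma bij_betw_nonnesting_perms:
  "bij_betw (\<lambda>(s, D). map (nth s) (track D 0 0))
     (permutations_of_set {1..n} \<times> dyck_paths n) (nonnesting_perms n)"
proof (rule bij_betw_byWitness[where f' = "\<lambda>w. (firsts w, steps_of w)"])
  have inv: "(firsts (map (nth s) (track D 0 0)), steps_of (map (nth s) (track D 0 0))) = (s, D)"
    if "s \<in> permutations_of_set {1..n}" and D: "D \<in> dyck_paths n" for s D
  proof -
    have s: "distinct s" "length s = n"
      using that by (auto simp: permutations_of_set_def distinct_card[symmetric])
    have "count_list D East = length s" using D s by (simp add: dyck_paths_iff)
    then show ?thesis
      using decode_track[of D s] dyck_prefix_le[OF D] s by simp
  qed
  show "\<forall>sD\<in>permutations_of_set {1..n} \<times> dyck_paths n.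
      (\<lambda>w. (firsts w, steps_of w)) ((\<lambda>(s, D). map (nth s) (track D 0 0)) sD) = sD"
    using inv by auto
  have W: "map (nth (firsts w)) (track (steps_of w) 0 0) = w"
      "firsts w \<in> permutations_of_set {1..n}" "steps_of w \<in> dyck_paths n"
    if "w \<in> nonnesting_perms n" for w
  proof -
    have w: "mset w = mset_set {1..n} + mset_set {1..n}" "nonnesting w"
      using that by (auto simp: nonnesting_perms_def permutations_of_multiset_def)
    have set: "set w = {1..n}" using arg_cong[OF w(1), of set_mset] by simp
    have two: "count (mset w) x = 2" if "x \<in> set w" for x
      using that unfolding set w(1) by simp
    have "length w = 2 * n" using arg_cong[OF w(1), of size] by simp
    \<comment> \<open>Splitting \<open>w\<close> at every \<open>i\<close> turns the prefix lemma
      into the diagonal condition at every vertex of \<open>steps_of w\<close>.\<close>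
    have app: "nonnesting (take i w @ drop i w)"
      "\<And>x. x \<in> set (take i w @ drop i w) \<Longrightarrow> count (mset (take i w @ drop i w)) x = 2" for i
      using w(2) two by simp_all
    show "map (nth (firsts w)) (track (steps_of w) 0 0) = w"
      using track_steps_of(1)[OF app, of "length w"] by simp
    show "firsts w \<in> permutations_of_set {1..n}"
      by (simp add: permutations_of_set_def set)
    have "length (firsts w) = n"
      using distinct_card[of "firsts w"] by (simp add: set)
    then have "count_list (steps_of w) East = n" "count_list (steps_of w) North = n"
      using length_eq_count_steps[of "steps_of w"] \<open>length w = 2 * n\<close>
      by (simp_all add: count_steps_of_East)
    then show "steps_of w \<in> dyck_paths n"
      using track_steps_of(2)[OF app] by (simp add: dyck_paths_iff take_steps_of)
  qed
  show "\<forall>w\<in>nonnesting_perms n. (\<lambda>(s, D). map (nth s) (track D 0 0)) (firsts w, steps_of w) = w"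
    using W(1) by simp
  show "(\<lambda>w. (firsts w, steps_of w)) ` nonnesting_perms n \<subseteq> permutations_of_set {1..n} \<times> dyck_paths n"
    using W(2,3) by auto
  show "(\<lambda>(s, D). map (nth s) (track D 0 0)) ` (permutations_of_set {1..n} \<times> dyck_paths n)
      \<subseteq> nonnesting_perms n"
  proof clarify
    fix s D assume "s \<in> permutations_of_set {1..n}" and D: "D \<in> dyck_paths n"
    then have s: "distinct s" "length s = n" "set s = {1..n}"
      by (auto simp: permutations_of_set_def distinct_card[symmetric])
    have "mset (map (nth s) (track D 0 0)) = mset (map (nth s) [0..<n]) + mset (map (nth s) [0..<n])"
      using D by (simp add: mset_track dyck_paths_iff)
    also have "map (nth s) [0..<n] = s" using s(2) by (auto simp: map_nth)
    also have "mset s = mset_set {1..n}" using s by (metis mset_set_set)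
    finally show "map (nth s) (track D 0 0) \<in> nonnesting_perms n"
      using nonnesting_track[OF D s(1,2)]
      by (simp add: nonnesting_perms_def permutations_of_multiset_def)
  qed
qed

theorem theorem2p1:
  fixes n :: nat and t u :: "'a::comm_ring_1"
  assumes "n \<ge> 1"
  shows "C_poly n t u = A_poly n t * N_poly n t u"
proof -
  let ?f = "\<lambda>w. t ^ des w * u ^ plat w"
  have "C_poly n t u =
      (\<Sum>(s, D)\<in>permutations_of_set {1..n} \<times> dyck_paths n. ?f (map (nth s) (track D 0 0)))"
    unfolding C_poly_def
    using sum.reindex_bij_betw[OF bij_betw_nonnesting_perms, of ?f n]
    by (simp add: case_prod_beta)
  also have "\<dots> = (\<Sum>s\<in>permutations_of_set {1..n}. \<Sum>D\<in>dyck_paths n. ?f (map (nth s) (track D 0 0)))"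
    by (rule sum.cartesian_product[symmetric])
  also have "\<dots> = (\<Sum>s\<in>permutations_of_set {1..n}. t ^ des s * N_poly n t u)"
    by (intro sum.cong refl sum_fixed_order) (auto simp: permutations_of_set_def distinct_card[symmetric])
  finally show ?thesis
    by (simp add: A_poly_def sum_distrib_right)
qed

end
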